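(* Let $r\in(0,\infty)$ and $d\in\mathbb N$. Assume that $X=(X_t)_{t\in T}$ is an $\mathbb R^d$-valued pathwise continuous process indexed by a compact metric space $T$ with $\mathbb E\|X\|_{\sup}^r<\infty$. Let $\mu$ be a finite Borel measure on $T$ with $\mathrm{supp}(\mu)=T$. Then for every $n\in\mathbb N$, $$e_{n,r}(X,C_{\mathbb R^d}(T))=e_{n,r}(X,M^b_{\mathbb R^d}(T))=e_{n,r}(X,L^\infty_{\mathbb R^d}(\mu)),$$ where $C_{\mathbb R^d}(T)$ and $M^b_{\mathbb R^d}(T)$ are equipped with the sup-norm $\|f\|_{\sup}=\sup_{t\in T}|f(t)|_\infty$ and $L^\infty_{\mathbb R^d}(\mu)$ is equipped with the norm $\|h\|_\infty=\mu\text{-}\mathrm{ess\,sup}\,|h|_\infty$. In particular, $$\mathcal C_{n,r}(X,C_{\mathbb R^d}(T))=\{\alpha\in\mathcal C_{n,r}(X,M^b_{\mathbb R^d}(T)):\alpha\subset C_{\mathbb R^d}(T)\}$$ $$=\{\alpha\in\mathcal C_{n,r}(X,L^\infty_{\mathbb R^d}(\mu)):\text{(a }\mu\text{-version of) }\alpha\subset C_{\mathbb R^d}(T)\}.$$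
   Context: $|\cdot|_\infty$ is the $\ell^\infty$-norm on $\mathbb R^d$. $C_{\mathbb R^d}(T)$ is the space of continuous functions $T\to\mathbb R^d$; $M^b_{\mathbb R^d}(T)$ is the space of bounded Borel measurable functions $T\to\mathbb R^d$ (functions, not classes). Since $\mathrm{supp}(\mu)=T$, the norms $\|\cdot\|_{\sup}$ and $\|\cdot\|_\infty$ coincide on $C_{\mathbb R^d}(T)$, so $C_{\mathbb R^d}(T)$ is identified with a Banach subspace of $L^\infty_{\mathbb R^d}(\mu)$; in the last set, the condition means that each element of $\alpha$ has a continuous $\mu$-version, and $\alpha$ is identified with the set of these continuous versions. The process $X$ is viewed as a random variable with values in each of the three spaces. For a random variable $X$ in a Banach space $(G,\|\cdot\|)$ and $n\in\mathbb N$, $$e_{n,r}(X,G):=\inf\Big\{\big(\mathbb E\min_{a\in\alpha}\|X-a\|^r\big)^{1/r}:\alpha\subset G,\ 1\le\mathrm{card}(\alpha)\le n\Big\},$$ and $\mathcal C_{n,r}(X,G)$ is the set of all $\alpha\subset G$ with $1\le\mathrm{card}(\alpha)\le n$ and $(\mathbb E\min_{a\in\alpha}\|X-a\|^r)^{1/r}=e_{n,r}(X,G)$. *)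

theory Defs
  imports "HOL-Probability.Probability"
begin

text \<open>
  A normed space is given by its carrier, its subtraction and its norm. This is the part of the
  structure that enters the quantization errors. An explicit carrier is used because
  \<open>L\<^sup>\<infinity>(\<mu>)\<close> depends on the measure \<open>\<mu>\<close> and so cannot be a type.
\<close>

record 'v normed_sp =
  pts :: "'v set"
  nsub :: "'v \<Rightarrow> 'v \<Rightarrow> 'v"
  nrm :: "'v \<Rightarrow> real"

text \<open>
  Errors take values in \<open>ennreal\<close>, so that an infinite \<open>r\<close>-th moment gives the error \<open>\<infinity>\<close>. There is
  no power function with real exponents on \<open>ennreal\<close>; this is \<open>x\<close> to the power \<open>1/r\<close> for \<open>r > 0\<close>.
\<close>

definition ennroot :: "real \<Rightarrow> ennreal \<Rightarrow> ennreal" where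
  "ennroot r x = (if x = \<infinity> then \<infinity> else ennreal (enn2real x powr (1 / r)))"

definition quant_err :: "'w measure \<Rightarrow> real \<Rightarrow> ('w \<Rightarrow> 'v) \<Rightarrow> 'v normed_sp \<Rightarrow> 'v set \<Rightarrow> ennreal" where
  "quant_err M r Y G \<alpha> =
     ennroot r (\<integral>\<^sup>+\<omega>. ennreal (Min ((\<lambda>a. nrm G (nsub G (Y \<omega>) a) powr r) ` \<alpha>)) \<partial>M)"

text \<open>Infinite sets have \<open>card\<close> equal to \<open>0\<close>, so all codebooks are finite and nonempty.\<close>

definition codebooks :: "nat \<Rightarrow> 'v normed_sp \<Rightarrow> 'v set set" where
  "codebooks n G = {\<alpha>. \<alpha> \<subseteq> pts G \<and> 1 \<le> card \<alpha> \<and> card \<alpha> \<le> n}"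

definition min_quant_err :: "'w measure \<Rightarrow> nat \<Rightarrow> real \<Rightarrow> ('w \<Rightarrow> 'v) \<Rightarrow> 'v normed_sp \<Rightarrow> ennreal" where
  "min_quant_err M n r Y G = (INF \<alpha>\<in>codebooks n G. quant_err M r Y G \<alpha>)"

definition opt_codebooks :: "'w measure \<Rightarrow> nat \<Rightarrow> real \<Rightarrow> ('w \<Rightarrow> 'v) \<Rightarrow> 'v normed_sp \<Rightarrow> 'v set set" where
  "opt_codebooks M n r Y G =
     {\<alpha> \<in> codebooks n G. quant_err M r Y G \<alpha> = min_quant_err M n r Y G}"

text \<open>
  The norm on \<open>\<real>\<^sup>d\<close> is the \<open>l\<^sup>\<infinity>\<close>-norm \<open>infnorm\<close>. The supremum is the real one; it is meaningful for
  bounded functions only.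
\<close>

definition sup_nrm :: "('t \<Rightarrow> real ^ 'd) \<Rightarrow> real" where
  "sup_nrm f = (SUP t. infnorm (f t))"

definition C_space :: "('t::topological_space \<Rightarrow> real ^ 'd) normed_sp" where
  "C_space = \<lparr>pts = {f. continuous_on UNIV f}, nsub = (\<lambda>f g t. f t - g t), nrm = sup_nrm\<rparr>"

definition Mb_space :: "('t::topological_space \<Rightarrow> real ^ 'd) normed_sp" where
  "Mb_space = \<lparr>pts = {f. f \<in> borel_measurable borel \<and> bounded (range f)},
               nsub = (\<lambda>f g t. f t - g t), nrm = sup_nrm\<rparr>"

definition ess_bdd :: "'t measure \<Rightarrow> ('t \<Rightarrow> real ^ 'd) set" where
  "ess_bdd \<mu> = {f \<in> borel_measurable \<mu>. esssup \<mu> (\<lambda>t. ereal (infnorm (f t))) < \<infinity>}"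

definition ae_eq :: "'t measure \<Rightarrow> (('t \<Rightarrow> real ^ 'd) \<times> ('t \<Rightarrow> real ^ 'd)) set" where
  "ae_eq \<mu> = {(f, g). f \<in> ess_bdd \<mu> \<and> g \<in> ess_bdd \<mu> \<and> (AE t in \<mu>. f t = g t)}"

definition ae_class :: "'t measure \<Rightarrow> ('t \<Rightarrow> real ^ 'd) \<Rightarrow> ('t \<Rightarrow> real ^ 'd) set" where
  "ae_class \<mu> f = ae_eq \<mu> `` {f}"

text \<open>
  Subtraction and norm are defined through representatives; \<open>nsub_Linf\<close> and \<open>nrm_Linf\<close> below show
  that they do not depend on the choice.
\<close>

definition Linf_space :: "'t measure \<Rightarrow> ('t \<Rightarrow> real ^ 'd) set normed_sp" where
  "Linf_space \<mu> =
     \<lparr>pts = ess_bdd \<mu> // ae_eq \<mu>,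
      nsub = (\<lambda>A B. \<Union>f\<in>A. \<Union>g\<in>B. ae_class \<mu> (\<lambda>t. f t - g t)),
      nrm = (\<lambda>A. the_elem ((\<lambda>f. real_of_ereal (esssup \<mu> (\<lambda>t. ereal (infnorm (f t))))) ` A))\<rparr>"

definition msupport :: "'t::topological_space measure \<Rightarrow> 't set" where
  "msupport \<mu> = {t. \<forall>U. open U \<and> t \<in> U \<longrightarrow> emeasure \<mu> U > 0}"

text \<open>
  The elements of \<open>\<alpha>\<close> are classes of functions. If the support of \<open>\<mu>\<close> is the whole space, each
  of them contains at most one continuous function.
\<close>

definition cont_versions :: "('t::topological_space \<Rightarrow> real ^ 'd) set set \<Rightarrow> ('t \<Rightarrow> real ^ 'd) set" where
  "cont_versions \<alpha> = {f. continuous_on UNIV f \<and> (\<exists>A\<in>\<alpha>. f \<in> A)}"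

lemma equiv_ae_eq: "equiv (ess_bdd \<mu>) (ae_eq \<mu>)"
proof (rule equivI)
  show "trans (ae_eq \<mu> :: (('a \<Rightarrow> real ^ 'b) \<times> _) set)"
  proof (rule transI)
    fix f g h :: "'a \<Rightarrow> real ^ 'b"
    assume "(f, g) \<in> ae_eq \<mu>" "(g, h) \<in> ae_eq \<mu>"
    moreover have "AE t in \<mu>. f t = h t"
      if "AE t in \<mu>. f t = g t" "AE t in \<mu>. g t = h t"
      using that by eventually_elim simp
    ultimately show "(f, h) \<in> ae_eq \<mu>"
      by (auto simp: ae_eq_def)
  qed
qed (auto simp: ae_eq_def refl_on_def sym_def eq_commute)

lemma infnorm_measurable [measurable]:
  "f \<in> borel_measurable \<mu> \<Longrightarrow> (\<lambda>t. infnorm (f t :: real ^ 'd)) \<in> borel_measurable \<mu>"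
  by (rule borel_measurable_continuous_on[OF continuous_on_infnorm[OF continuous_on_id]])

lemma ess_bdd_iff:
  "f \<in> ess_bdd \<mu> \<longleftrightarrow> f \<in> borel_measurable \<mu> \<and> (\<exists>C. AE t in \<mu>. infnorm (f t :: real ^ 'd) \<le> C)"
proof safe
  assume f: "f \<in> ess_bdd \<mu>"
  then show meas: "f \<in> borel_measurable \<mu>"
    by (simp add: ess_bdd_def)
  have lt: "esssup \<mu> (\<lambda>t. ereal (infnorm (f t))) < \<infinity>"
    using f by (simp add: ess_bdd_def)
  then obtain C where C: "esssup \<mu> (\<lambda>t. ereal (infnorm (f t))) < ereal C"
    by (metis less_ereal.simps(2) less_PInf_Ex_of_nat)
  have "AE t in \<mu>. ereal (infnorm (f t)) \<le> esssup \<mu> (\<lambda>t. ereal (infnorm (f t)))"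
    by (rule esssup_AE)
  then have "AE t in \<mu>. infnorm (f t) \<le> C"
    by eventually_elim (use C in \<open>metis ereal_less_eq(3) less_imp_le order_trans\<close>)
  then show "\<exists>C. AE t in \<mu>. infnorm (f t) \<le> C" ..
next
  fix C assume [measurable]: "f \<in> borel_measurable \<mu>" and C: "AE t in \<mu>. infnorm (f t) \<le> C"
  have "esssup \<mu> (\<lambda>t. ereal (infnorm (f t))) \<le> ereal C"
    by (rule esssup_I) (use C in auto)
  then have "esssup \<mu> (\<lambda>t. ereal (infnorm (f t))) < \<infinity>"
    using order_le_less_trans by fastforce
  then show "f \<in> ess_bdd \<mu>"
    by (simp add: ess_bdd_def)
qed

lemma ess_bdd_diff:
  fixes f g :: "'t \<Rightarrow> real ^ 'd"
  assumes "f \<in> ess_bdd \<mu>" "g \<in> ess_bdd \<mu>"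
  shows "(\<lambda>t. f t - g t) \<in> ess_bdd \<mu>"
proof -
  obtain C D where "AE t in \<mu>. infnorm (f t) \<le> C" "AE t in \<mu>. infnorm (g t) \<le> D"
    using assms by (auto simp: ess_bdd_iff)
  then have "AE t in \<mu>. infnorm (f t - g t) \<le> C + D"
  proof eventually_elim
    case (elim t)
    then show ?case
      using infnorm_triangle[of "f t" "- g t"] by (simp add: infnorm_neg)
  qed
  then show ?thesis
    using assms by (auto simp: ess_bdd_iff)
qed

lemma nsub_Linf:
  fixes f g :: "'t \<Rightarrow> real ^ 'd"
  assumes "f \<in> ess_bdd \<mu>" "g \<in> ess_bdd \<mu>"
  shows "nsub (Linf_space \<mu>) (ae_class \<mu> f) (ae_class \<mu> g) = ae_class \<mu> (\<lambda>t. f t - g t)"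
proof -
  have "ae_class \<mu> (\<lambda>t. f' t - g' t) = ae_class \<mu> (\<lambda>t. f t - g t)"
    if "f' \<in> ae_class \<mu> f" "g' \<in> ae_class \<mu> g" for f' g'
  proof -
    have 1: "f' \<in> ess_bdd \<mu>" "g' \<in> ess_bdd \<mu>"
      and 2: "AE t in \<mu>. f t = f' t" "AE t in \<mu>. g t = g' t"
      using that by (auto simp: ae_class_def ae_eq_def)
    from 2 have "AE t in \<mu>. f' t - g' t = f t - g t"
      by eventually_elim simp
    then have "((\<lambda>t. f' t - g' t), (\<lambda>t. f t - g t)) \<in> ae_eq \<mu>"
      using 1 assms by (simp add: ae_eq_def ess_bdd_diff)
    then show ?thesis
      unfolding ae_class_def by (rule equiv_class_eq[OF equiv_ae_eq])
  qed
  moreover have "f \<in> ae_class \<mu> f" "g \<in> ae_class \<mu> g"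
    using assms by (auto simp: ae_class_def ae_eq_def)
  ultimately show ?thesis
    unfolding Linf_space_def normed_sp.simps by blast
qed

lemma nrm_Linf:
  fixes f :: "'t \<Rightarrow> real ^ 'd"
  assumes "f \<in> ess_bdd \<mu>"
  shows "nrm (Linf_space \<mu>) (ae_class \<mu> f) =
         real_of_ereal (esssup \<mu> (\<lambda>t. ereal (infnorm (f t))))"
proof -
  have "esssup \<mu> (\<lambda>t. ereal (infnorm (g t))) = esssup \<mu> (\<lambda>t. ereal (infnorm (f t)))"
    if "g \<in> ae_class \<mu> f" for g
  proof -
    have [measurable]: "g \<in> borel_measurable \<mu>" "f \<in> borel_measurable \<mu>"
      and ae: "AE t in \<mu>. f t = g t"
      using that by (auto simp: ae_class_def ae_eq_def ess_bdd_def)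
    have "AE t in \<mu>. ereal (infnorm (g t)) = ereal (infnorm (f t))"
      using ae by eventually_elim simp
    then show ?thesis
      by (intro esssup_AE_cong) simp_all
  qed
  moreover have "f \<in> ae_class \<mu> f"
    using assms by (auto simp: ae_class_def ae_eq_def)
  ultimately have "(\<lambda>g. real_of_ereal (esssup \<mu> (\<lambda>t. ereal (infnorm (g t))))) ` ae_class \<mu> f
      = {real_of_ereal (esssup \<mu> (\<lambda>t. ereal (infnorm (f t))))}"
    by (smt (verit, ccfv_SIG) image_cong image_constant)
  then show ?thesis
    by (simp add: Linf_space_def)
qed

end

theory Submission
  imports Defs
begin

text \<open>
  Enlarging the space of admissible codewords from continuous functions to bounded measurable
  functions, and passing from these to their \<open>\<mu>\<close>-classes, can only decrease the quantization error.
  The point is the converse: a codebook in \<open>L\<^sup>\<infinity>(\<mu>)\<close> can be replaced by one of continuous functions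
  at an arbitrarily small cost. This is achieved by smoothing. With the tent kernel
  \<open>k(t, s) = max 0 (\<delta> - d(t, s))\<close>, a class with representative \<open>a\<close> is replaced by the weighted mean
  \<open>a'(t) = \<integral> k(t, s) a(s) d\<mu>(s) / \<integral> k(t, s) d\<mu>(s)\<close>. The denominator is positive because \<open>\<mu>\<close> has full
  support, and \<open>a'\<close> is continuous. For a path \<open>f\<close>, the value \<open>a'(t)\<close> is an average of vectors \<open>a(s)\<close>
  with \<open>d(t, s) < \<delta>\<close>, and almost all of these lie within \<open>\<parallel>f - a\<parallel>\<^sub>\<infinity>\<close> of \<open>f(s)\<close>. Hence
  (\<open>sup_nrm_tent_mean_le\<close>)

  \<open>\<parallel>f - a'\<parallel> \<le> \<parallel>f - a\<parallel>\<^sub>\<infinity> + w(f, \<delta>)\<close>,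

  where \<open>w(f, \<delta>)\<close> is the modulus of continuity. On the compact space \<open>T\<close> it tends to \<open>0\<close> as \<open>\<delta> \<rightarrow> 0\<close>
  for every path, and it is at most twice the norm of the path, so its \<open>r\<close>-th moment tends to \<open>0\<close> by
  dominated convergence (\<open>osc_moment_tendsto_0\<close>). The elementary bound
  \<open>(x + w)\<^sup>r \<le> (1 + \<theta>)\<^sup>r x\<^sup>r + (1 + 1/\<theta>)\<^sup>r w\<^sup>r\<close> works for all \<open>r > 0\<close> and turns this into convergence of the
  errors, as \<open>\<theta>\<close> is arbitrary (\<open>min_C_le_min_Linf\<close>).

  For an integrand of unknown measurability, such as the distance of the random path to a codebook in
  \<open>L\<^sup>\<infinity>(\<mu>)\<close>, the integral \<open>\<integral>\<^sup>+\<close> is the lower integral. It is subadditive if the second summand is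
  measurable (\<open>nn_integral_add_le\<close>). Here this summand is a power of the modulus of continuity, a
  countable supremum of measurable functions.

  The description of the optimal codebooks follows: on continuous functions the essential supremum
  and the supremum agree and a \<open>\<mu>\<close>-class contains at most one continuous function, so
  \<open>\<alpha> \<mapsto> {[a] | a \<in> \<alpha>}\<close> preserves cardinalities and errors and is inverted by taking continuous versions.
\<close>

section \<open>Lower integrals and moments\<close>

text \<open>
  A simple function below \<open>f + g\<close> exceeds \<open>g\<close> by at most a measurable function below \<open>f\<close>, so for the lower
  integral subadditivity survives as long as \<open>g\<close> is measurable.
\<close>

lemma nn_integral_add_le:
  assumes [measurable]: "g \<in> borel_measurable M"
  shows "(\<integral>\<^sup>+x. f x + g x \<partial>M) \<le> (\<integral>\<^sup>+x. f x \<partial>M) + (\<integral>\<^sup>+x. g x \<partial>M)"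
  unfolding nn_integral_def[of M "\<lambda>x. f x + g x"]
proof (rule SUP_least, safe)
  fix s assume s: "simple_function M s" and le: "s \<le> (\<lambda>x. f x + g x)"
  have [measurable]: "s \<in> borel_measurable M"
    using s by (rule borel_measurable_simple_function)
  \<comment> \<open>In \<open>ennreal\<close> the difference \<open>\<top> - \<top>\<close> is \<open>\<top>\<close>, hence the separate value where \<open>g\<close> is infinite.\<close>
  define h where "h x = (if g x = \<top> then 0 else s x - g x)" for x
  have [measurable]: "h \<in> borel_measurable M"
    unfolding h_def by measurable
  have "integral\<^sup>S M s = (\<integral>\<^sup>+x. s x \<partial>M)"
    using s by (simp add: nn_integral_eq_simple_integral)
  also have "\<dots> \<le> (\<integral>\<^sup>+x. h x + g x \<partial>M)"
  proof (rule nn_integral_mono)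
    fix x
    show "s x \<le> h x + g x"
      using ennreal_minus_le_iff[of "s x" "g x" "s x - g x"] by (auto simp: h_def add.commute)
  qed
  also have "\<dots> = (\<integral>\<^sup>+x. h x \<partial>M) + (\<integral>\<^sup>+x. g x \<partial>M)"
    by (rule nn_integral_add) measurable
  also have "(\<integral>\<^sup>+x. h x \<partial>M) \<le> (\<integral>\<^sup>+x. f x \<partial>M)"
  proof (rule nn_integral_mono)
    fix x
    show "h x \<le> f x"
      using le_funD[OF le, of x] by (auto simp: h_def ennreal_minus_le_iff add.commute)
  qed
  finally show "integral\<^sup>S M s \<le> (\<integral>\<^sup>+x. f x \<partial>M) + (\<integral>\<^sup>+x. g x \<partial>M)"
    by (simp add: add_right_mono)
qed

lemma nn_integral_cmult_le:
  assumes "c > 0"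
  shows "(\<integral>\<^sup>+x. ennreal c * f x \<partial>M) \<le> ennreal c * (\<integral>\<^sup>+x. f x \<partial>M)"
  unfolding nn_integral_def[of M "\<lambda>x. ennreal c * f x"]
proof (rule SUP_least, safe)
  fix s assume s: "simple_function M s" and le: "s \<le> (\<lambda>x. ennreal c * f x)"
  have [measurable]: "s \<in> borel_measurable M"
    using s by (rule borel_measurable_simple_function)
  have "ennreal c * ennreal (1 / c) = 1"
    using assms by (simp flip: ennreal_mult')
  then have cancel: "ennreal c * (ennreal (1 / c) * y) = y"
    and cancel': "ennreal (1 / c) * (ennreal c * y) = y" for y
    by (metis mult.assoc mult.left_neutral, metis mult.assoc mult.commute mult.left_neutral)
  have "integral\<^sup>S M s = (\<integral>\<^sup>+x. ennreal c * (ennreal (1 / c) * s x) \<partial>M)"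
    using s by (simp add: cancel nn_integral_eq_simple_integral)
  also have "\<dots> = ennreal c * (\<integral>\<^sup>+x. ennreal (1 / c) * s x \<partial>M)"
    by (rule nn_integral_cmult) measurable
  also have "(\<integral>\<^sup>+x. ennreal (1 / c) * s x \<partial>M) \<le> (\<integral>\<^sup>+x. f x \<partial>M)"
  proof (rule nn_integral_mono)
    fix x
    have "ennreal (1 / c) * s x \<le> ennreal (1 / c) * (ennreal c * f x)"
      using le by (intro mult_left_mono) (auto dest: le_funD)
    then show "ennreal (1 / c) * s x \<le> f x"
      by (simp only: cancel')
  qed
  finally show "integral\<^sup>S M s \<le> ennreal c * (\<integral>\<^sup>+x. f x \<partial>M)"
    by (simp add: mult_left_mono)
qed

text \<open>
  Either \<open>w\<close> is at most \<open>\<theta> x\<close>, or \<open>x\<close> is at most \<open>w / \<theta>\<close>. Unlike Minkowski's inequality, the result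
  also covers \<open>r < 1\<close>, and its first constant tends to \<open>1\<close> as \<open>\<theta> \<rightarrow> 0\<close>.
\<close>

lemma powr_add_le:
  fixes x w \<theta> r :: real
  assumes "x \<ge> 0" "w \<ge> 0" "\<theta> > 0" "r > 0"
  shows "(x + w) powr r \<le> (1 + \<theta>) powr r * x powr r + (1 + 1 / \<theta>) powr r * w powr r"
proof (cases "w \<le> \<theta> * x")
  case True
  then have "(x + w) powr r \<le> ((1 + \<theta>) * x) powr r"
    using assms by (intro powr_mono2) (auto simp: algebra_simps)
  also have "\<dots> = (1 + \<theta>) powr r * x powr r"
    using assms by (simp add: powr_mult)
  finally show ?thesis
    by (smt (verit) powr_ge_zero mult_nonneg_nonneg)
next
  case False
  then have "x + w \<le> (1 + 1 / \<theta>) * w"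
    using assms by (simp add: field_simps)
  then have "(x + w) powr r \<le> ((1 + 1 / \<theta>) * w) powr r"
    using assms by (intro powr_mono2) auto
  also have "\<dots> = (1 + 1 / \<theta>) powr r * w powr r"
    using assms by (simp add: powr_mult)
  finally show ?thesis
    by (smt (verit) powr_ge_zero mult_nonneg_nonneg)
qed

section \<open>Monotonicity of quantization errors\<close>

lemma ennroot_mono:
  assumes "r > 0" "x \<le> y"
  shows "ennroot r x \<le> ennroot r y"
proof (cases "y = \<infinity>")
  case False
  then have "x \<noteq> \<infinity>" "enn2real x \<le> enn2real y"
    using assms(2) by (auto simp: top_unique enn2real_mono less_top)
  then show ?thesis
    using assms(1) False by (auto simp: ennroot_def intro!: ennreal_leI powr_mono2)
qed (simp add: ennroot_def)

lemma Min_image_mono_match: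
  fixes f :: "'a \<Rightarrow> real" and g :: "'b \<Rightarrow> real"
  assumes "finite A" "A \<noteq> {}" "finite B" "\<And>a. a \<in> A \<Longrightarrow> \<exists>b\<in>B. g b \<le> f a"
  shows "Min (g ` B) \<le> Min (f ` A)"
proof -
  obtain a where "a \<in> A" "Min (f ` A) = f a"
    using Min_in[of "f ` A"] assms(1,2) by fastforce
  with assms(4) obtain b where "b \<in> B" "g b \<le> Min (f ` A)"
    by metis
  then show ?thesis
    using assms(3) by (meson Min_le finite_imageI image_eqI order_trans)
qed

lemma codebook_finite_nonempty:
  assumes "\<alpha> \<in> codebooks n G"
  shows "finite \<alpha>" "\<alpha> \<noteq> {}" "\<alpha> \<subseteq> pts G"
  using assms card_gt_0_iff[of \<alpha>] by (auto simp: codebooks_def)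

lemma codebook_image:
  assumes "\<alpha> \<in> codebooks n G" "\<And>a. a \<in> \<alpha> \<Longrightarrow> h a \<in> pts H"
  shows "h ` \<alpha> \<in> codebooks n H"
proof -
  have "card (h ` \<alpha>) \<noteq> 0"
    using codebook_finite_nonempty[OF assms(1)] by simp
  moreover have "card (h ` \<alpha>) \<le> n"
    using card_image_le[OF codebook_finite_nonempty(1)[OF assms(1)], of h] assms(1)
    by (simp add: codebooks_def)
  ultimately show ?thesis
    using assms(2) by (auto simp: codebooks_def)
qed

lemma quant_err_image_le:
  assumes "r > 0" "finite \<alpha>" "\<alpha> \<noteq> {}"
    and "\<And>\<omega> a. \<omega> \<in> space M \<Longrightarrow> a \<in> \<alpha> \<Longrightarrow>
           0 \<le> nrm H (nsub H (Z \<omega>) (h a)) \<and>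
           nrm H (nsub H (Z \<omega>) (h a)) \<le> nrm G (nsub G (Y \<omega>) a)"
  shows "quant_err M r Z H (h ` \<alpha>) \<le> quant_err M r Y G \<alpha>"
  unfolding quant_err_def
proof (intro ennroot_mono nn_integral_mono ennreal_leI Min_image_mono_match)
  fix \<omega> a assume "\<omega> \<in> space M" "a \<in> \<alpha>"
  then show "\<exists>b\<in>h ` \<alpha>. nrm H (nsub H (Z \<omega>) b) powr r \<le> nrm G (nsub G (Y \<omega>) a) powr r"
    using assms(1) assms(4)[of \<omega> a] by (intro bexI[of _ "h a"] powr_mono2) auto
qed (use assms in auto)

section \<open>The norms\<close>

lemma infnorm_le_iff_cart:
  fixes x :: "real ^ 'd"
  shows "infnorm x \<le> c \<longleftrightarrow> (\<forall>i. \<bar>x $ i\<bar> \<le> c)"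
proof
  assume "\<forall>i. \<bar>x $ i\<bar> \<le> c"
  then show "infnorm x \<le> c"
    unfolding infnorm_cart by (intro cSup_least) auto
qed (meson component_le_infnorm_cart order_trans)

lemma infnorm_diff_triangle:
  fixes x y z :: "real ^ 'd"
  shows "infnorm (x - z) \<le> infnorm (x - y) + infnorm (y - z)"
  using infnorm_triangle[of "x - y" "y - z"] by simp

lemma infnorm_le_sup_nrm:
  fixes f :: "'t \<Rightarrow> real ^ 'd"
  assumes "bounded (range f)"
  shows "infnorm (f t) \<le> sup_nrm f"
proof -
  obtain B where "\<And>t. norm (f t) \<le> B"
    using assms by (auto simp: bounded_iff)
  then have "bdd_above (range (\<lambda>t. infnorm (f t)))"
    by (intro bdd_aboveI2[where M = B]) (meson infnorm_le_norm order_trans)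
  then show ?thesis
    unfolding sup_nrm_def by (rule cSUP_upper2[OF _ UNIV_I order_refl])
qed

lemma sup_nrm_least:
  fixes f :: "'t \<Rightarrow> real ^ 'd"
  assumes "\<And>t. infnorm (f t) \<le> c"
  shows "sup_nrm f \<le> c"
  unfolding sup_nrm_def using assms by (intro cSUP_least) auto

lemma sup_nrm_nonneg:
  fixes f :: "'t \<Rightarrow> real ^ 'd"
  assumes "bounded (range f)"
  shows "0 \<le> sup_nrm f"
  using infnorm_le_sup_nrm[OF assms] infnorm_pos_le order_trans by blast

text \<open>
  For essentially bounded \<open>f\<close> this is the norm of the class of \<open>f\<close>, see \<open>nrm_Linf\<close>.
\<close>

definition ess_nrm :: "'t measure \<Rightarrow> ('t \<Rightarrow> real ^ 'd) \<Rightarrow> real" where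
  "ess_nrm \<mu> f = real_of_ereal (esssup \<mu> (\<lambda>t. ereal (infnorm (f t))))"

lemma AE_infnorm_le_ess_nrm:
  fixes f :: "'t \<Rightarrow> real ^ 'd"
  assumes "f \<in> ess_bdd \<mu>"
  shows "AE t in \<mu>. infnorm (f t) \<le> ess_nrm \<mu> f"
proof -
  have fin: "esssup \<mu> (\<lambda>t. ereal (infnorm (f t))) < \<infinity>"
    using assms by (simp add: ess_bdd_def)
  have "AE t in \<mu>. ereal (infnorm (f t)) \<le> esssup \<mu> (\<lambda>t. ereal (infnorm (f t)))"
    by (rule esssup_AE)
  then show ?thesis
  proof eventually_elim
    case (elim t)
    then show ?case
      using fin unfolding ess_nrm_def
      by (cases "esssup \<mu> (\<lambda>t. ereal (infnorm (f t)))") auto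
  qed
qed

text \<open>
  If \<open>\<mu>\<close> vanishes, the essential supremum is \<open>-\<infinity>\<close>, which is converted to the real number \<open>0\<close>. Thus
  \<open>c\<close> has to be nonnegative.
\<close>

lemma ess_nrm_least:
  fixes f :: "'t \<Rightarrow> real ^ 'd"
  assumes "f \<in> borel_measurable \<mu>" "AE t in \<mu>. infnorm (f t) \<le> c" "0 \<le> c"
  shows "ess_nrm \<mu> f \<le> c"
proof -
  note [measurable] = assms(1)
  have "esssup \<mu> (\<lambda>t. ereal (infnorm (f t))) \<le> ereal c"
    by (rule esssup_I) (use assms in auto)
  then show ?thesis
    using assms(3) unfolding ess_nrm_def
    by (cases "esssup \<mu> (\<lambda>t. ereal (infnorm (f t)))") auto
qed

lemma Linf_point_class:
  assumes "A \<in> pts (Linf_space \<mu>)" "a \<in> A"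
  shows "a \<in> ess_bdd \<mu>" "A = ae_class \<mu> a"
proof -
  have A: "A \<in> ess_bdd \<mu> // ae_eq \<mu>"
    using assms(1) by (simp add: Linf_space_def)
  show "a \<in> ess_bdd \<mu>"
    using in_quotient_imp_subset[OF equiv_ae_eq A] assms(2) by blast
  then have "a \<in> ae_class \<mu> a"
    by (simp add: ae_class_def ae_eq_def)
  moreover have "ae_class \<mu> a \<in> ess_bdd \<mu> // ae_eq \<mu>"
    using \<open>a \<in> ess_bdd \<mu>\<close> unfolding ae_class_def by (rule quotientI)
  ultimately show "A = ae_class \<mu> a"
    using quotient_disj[OF equiv_ae_eq A] assms(2) by blast
qed

lemma Linf_point_nonempty:
  assumes "A \<in> pts (Linf_space \<mu>)"
  shows "A \<noteq> {}"
  using assms in_quotient_imp_non_empty[OF equiv_ae_eq] by (auto simp: Linf_space_def)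

lemma ae_class_point:
  assumes "f \<in> ess_bdd \<mu>"
  shows "ae_class \<mu> f \<in> pts (Linf_space \<mu>)" "f \<in> ae_class \<mu> f"
  using assms by (auto simp: Linf_space_def ae_class_def ae_eq_def quotient_def)

lemma nrm_Linf_diff:
  fixes f g :: "'t \<Rightarrow> real ^ 'd"
  assumes "f \<in> ess_bdd \<mu>" "g \<in> ess_bdd \<mu>"
  shows "nrm (Linf_space \<mu>) (nsub (Linf_space \<mu>) (ae_class \<mu> f) (ae_class \<mu> g))
         = ess_nrm \<mu> (\<lambda>t. f t - g t)"
  using assms by (simp add: nsub_Linf nrm_Linf ess_bdd_diff ess_nrm_def)

section \<open>The modulus of continuity\<close>

text \<open>
  The supremum extends over pairs from a set \<open>D\<close>, later countable and dense, so that the modulus of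
  a process is a countable supremum and thereby measurable.
\<close>

definition osc :: "'t::metric_space set \<Rightarrow> real \<Rightarrow> ('t \<Rightarrow> real ^ 'd) \<Rightarrow> real" where
  "osc D \<delta> f = (SUP p\<in>{p \<in> D \<times> D. dist (fst p) (snd p) < \<delta>}. infnorm (f (fst p) - f (snd p)))"

lemma continuous_bounded_range:
  fixes f :: "'t::topological_space \<Rightarrow> real ^ 'd"
  assumes "compact (UNIV :: 't set)" "continuous_on UNIV f"
  shows "bounded (range f)"
  using compact_imp_bounded[OF compact_continuous_image[OF assms(2,1)]] .

lemma infnorm_diff_le_2_sup_nrm:
  fixes f :: "'t \<Rightarrow> real ^ 'd"
  assumes "bounded (range f)"
  shows "infnorm (f s - f t) \<le> 2 * sup_nrm f"
  using infnorm_triangle[of "f s" "- f t"] infnorm_le_sup_nrm[OF assms, of s]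
    infnorm_le_sup_nrm[OF assms, of t] by (simp add: infnorm_neg)

lemma osc_bdd_above:
  fixes f :: "'t::metric_space \<Rightarrow> real ^ 'd"
  assumes "bounded (range f)"
  shows "bdd_above ((\<lambda>p. infnorm (f (fst p) - f (snd p))) ` S)"
  using infnorm_diff_le_2_sup_nrm[OF assms] by (intro bdd_aboveI2)

lemma osc_least:
  fixes f :: "'t::metric_space \<Rightarrow> real ^ 'd"
  assumes "D \<noteq> {}" "\<delta> > 0" "\<And>s t. dist s t < \<delta> \<Longrightarrow> infnorm (f s - f t) \<le> c"
  shows "osc D \<delta> f \<le> c"
  unfolding osc_def
proof (rule cSUP_least)
  obtain s where "s \<in> D"
    using assms(1) by blast
  then have "(s, s) \<in> {p \<in> D \<times> D. dist (fst p) (snd p) < \<delta>}"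
    using assms(2) by simp
  then show "{p \<in> D \<times> D. dist (fst p) (snd p) < \<delta>} \<noteq> {}"
    by blast
qed (use assms(3) in auto)

text \<open>
  The pairs closer than \<open>\<delta>\<close> form an open set, so those from the dense set \<open>D \<times> D\<close> are dense in it;
  the pairs that satisfy the bound form a closed set.
\<close>

lemma infnorm_diff_le_osc:
  fixes f :: "'t::metric_space \<Rightarrow> real ^ 'd"
  assumes "continuous_on UNIV f" "bounded (range f)" "closure D = UNIV" "dist s t < \<delta>"
  shows "infnorm (f s - f t) \<le> osc D \<delta> f"
proof -
  let ?U = "{p :: 't \<times> 't. dist (fst p) (snd p) < \<delta>}"
  let ?C = "{p. infnorm (f (fst p) - f (snd p)) \<le> osc D \<delta> f}"
  have "?U \<inter> D \<times> D \<subseteq> ?C"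
    unfolding osc_def
    by (auto intro!: cSUP_upper2[OF osc_bdd_above[OF assms(2)] _ order_refl])
  moreover have "continuous_on UNIV (\<lambda>p. f (fst p))" "continuous_on UNIV (\<lambda>p. f (snd p))"
    by (auto intro!: continuous_intros continuous_on_compose2[OF assms(1)])
  then have "closed ?C"
    by (intro closed_Collect_le continuous_intros)
  ultimately have "closure (?U \<inter> D \<times> D) \<subseteq> ?C"
    by (rule closure_minimal)
  moreover have "open ?U"
    by (intro open_Collect_less continuous_intros)
  then have "?U \<inter> closure (D \<times> D) \<subseteq> closure (?U \<inter> D \<times> D)"
    by (rule open_Int_closure_subset)
  moreover have "(s, t) \<in> ?U \<inter> closure (D \<times> D)"
    using assms(3,4) by (simp add: closure_Times)
  ultimately have "(s, t) \<in> ?C"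
    by blast
  then show ?thesis
    by simp
qed

lemma osc_nonneg:
  fixes f :: "'t::metric_space \<Rightarrow> real ^ 'd"
  assumes "continuous_on UNIV f" "bounded (range f)" "closure D = UNIV" "\<delta> > 0"
  shows "0 \<le> osc D \<delta> f"
  using infnorm_diff_le_osc[OF assms(1-3), of undefined undefined] assms(4)
  by (simp add: infnorm_0)

lemma osc_tendsto_0:
  fixes f :: "'t::metric_space \<Rightarrow> real ^ 'd"
  assumes "compact (UNIV :: 't set)" "continuous_on UNIV f" "closure D = UNIV"
  shows "(\<lambda>k. osc D (1 / Suc k) f) \<longlonglongrightarrow> 0"
proof (rule LIMSEQ_I)
  fix e :: real assume "e > 0"
  have "uniformly_continuous_on UNIV f"
    using assms(2,1) by (rule compact_uniformly_continuous)
  then obtain d where d: "d > 0" "\<And>s t. dist s t < d \<Longrightarrow> dist (f s) (f t) < e / 2"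
    unfolding uniformly_continuous_on_def using \<open>e > 0\<close> by (metis UNIV_I half_gt_zero)
  obtain N where N: "1 / Suc N < d"
    using \<open>d > 0\<close> nat_approx_posE by blast
  have "norm (osc D (1 / Suc k) f - 0) < e" if "k \<ge> N" for k
  proof -
    have "1 / Suc k \<le> 1 / Suc N"
      using that by (simp add: frac_le)
    have "osc D (1 / Suc k) f \<le> e / 2"
    proof (rule osc_least)
      show "D \<noteq> {}"
        using assms(3) by auto
      fix s t :: 't assume "dist s t < 1 / Suc k"
      then have "dist (f s) (f t) < e / 2"
        using d(2) N \<open>1 / Suc k \<le> 1 / Suc N\<close> by simp
      then show "infnorm (f s - f t) \<le> e / 2"
        using infnorm_le_norm[of "f s - f t"] by (simp add: dist_norm)
    qed simp
    moreover have "0 \<le> osc D (1 / Suc k) f"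
      by (rule osc_nonneg[OF assms(2) continuous_bounded_range[OF assms(1,2)] assms(3)]) simp
    ultimately show ?thesis
      using \<open>e > 0\<close> by simp
  qed
  then show "\<exists>N. \<forall>k\<ge>N. norm (osc D (1 / Suc k) f - 0) < e"
    by blast
qed

text \<open>
  The centres of finite covers by balls of radius \<open>1 / Suc k\<close>, for all \<open>k\<close>, are dense.
\<close>

lemma compact_metric_countable_dense:
  assumes "compact (UNIV :: 't::metric_space set)"
  obtains D :: "'t::metric_space set" where "countable D" "closure D = UNIV"
proof -
  have "\<exists>F. finite F \<and> F \<subseteq> (UNIV :: 't set) \<and> UNIV \<subseteq> (\<Union>x\<in>F. ball x (1 / Suc k))" for k
    by (rule seq_compact_imp_totally_bounded[OF compact_imp_seq_compact[OF assms], rule_format]) simp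
  then obtain F :: "nat \<Rightarrow> 't set"
    where F: "\<And>k. finite (F k)" "\<And>k. UNIV \<subseteq> (\<Union>x\<in>F k. ball x (1 / Suc k))"
    by metis
  have "closure (\<Union>k. F k) = UNIV"
  proof (intro equalityI subsetI)
    fix t :: 't
    show "t \<in> closure (\<Union>k. F k)"
      unfolding closure_approachable
    proof safe
      fix e :: real assume "e > 0"
      then obtain k where "1 / Suc k < e"
        using nat_approx_posE by blast
      moreover obtain x where "x \<in> F k" "dist x t < 1 / Suc k"
        using subsetD[OF F(2) UNIV_I, of t k] by (auto simp del: of_nat_Suc)
      ultimately show "\<exists>x\<in>\<Union>k. F k. dist x t < e"
        by (intro bexI[of _ x]) auto
    qed
  qed simp
  moreover have "countable (\<Union>k. F k)"
    using F(1) by (simp add: countable_finite)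
  ultimately show ?thesis
    using that by blast
qed

text \<open>
  Dominated convergence, with the modulus for \<open>\<delta> = 1\<close> as the dominating function. Its \<open>r\<close>-th moment is
  finite because it is at most twice the norm of the path.
\<close>

lemma osc_moment_tendsto_0:
  fixes X :: "'t::metric_space \<Rightarrow> 'w \<Rightarrow> real ^ 'd"
  assumes "r > 0" "compact (UNIV :: 't set)" "countable D" "closure D = UNIV"
    and meas: "\<And>t. X t \<in> borel_measurable M"
    and cont: "\<And>\<omega>. \<omega> \<in> space M \<Longrightarrow> continuous_on UNIV (\<lambda>t. X t \<omega>)"
    and fin: "(\<integral>\<^sup>+\<omega>. ennreal (sup_nrm (\<lambda>t. X t \<omega>) powr r) \<partial>M) < \<infinity>"
  shows "(\<lambda>\<omega>. osc D \<delta> (\<lambda>t. X t \<omega>)) \<in> borel_measurable M" (is ?meas)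
    and "(\<lambda>k. \<integral>\<^sup>+\<omega>. ennreal (osc D (1 / Suc k) (\<lambda>t. X t \<omega>) powr r) \<partial>M) \<longlonglongrightarrow> 0" (is ?lim)
proof -
  note bdd = continuous_bounded_range[OF assms(2) cont]
  have M [measurable]: "(\<lambda>\<omega>. osc D \<delta> (\<lambda>t. X t \<omega>)) \<in> borel_measurable M" for \<delta>
    unfolding osc_def
  proof (rule borel_measurable_cSUP)
    show "countable {p \<in> D \<times> D. dist (fst p) (snd p) < \<delta>}"
      by (rule countable_subset[OF Collect_subset countable_SIGMA[OF assms(3) assms(3)]])
    show "bdd_above ((\<lambda>p. infnorm (X (fst p) \<omega> - X (snd p) \<omega>))
            ` {p \<in> D \<times> D. dist (fst p) (snd p) < \<delta>})" if "\<omega> \<in> space M" for \<omega>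
      by (rule osc_bdd_above[OF bdd[OF that]])
    show "(\<lambda>\<omega>. infnorm (X (fst p) \<omega> - X (snd p) \<omega>)) \<in> borel_measurable M" for p
      by (rule infnorm_measurable[OF borel_measurable_diff[OF meas meas]])
  qed
  then show ?meas .
  have le: "osc D (1 / Suc k) (\<lambda>t. X t \<omega>) \<le> sup_nrm (\<lambda>t. X t \<omega>) * 2"
    if "\<omega> \<in> space M" for \<omega> k
  proof (rule osc_least)
    show "D \<noteq> {}"
      using assms(4) by auto
  qed (use infnorm_diff_le_2_sup_nrm[OF bdd[OF that]] in \<open>simp_all add: mult.commute\<close>)
  have nn: "0 \<le> osc D (1 / Suc k) (\<lambda>t. X t \<omega>)" if "\<omega> \<in> space M" for \<omega> k
    by (rule osc_nonneg[OF cont[OF that] bdd[OF that] assms(4)]) simp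
  have mono: "osc D (1 / Suc k) (\<lambda>t. X t \<omega>) \<le> osc D (1 / Suc 0) (\<lambda>t. X t \<omega>)"
    if "\<omega> \<in> space M" for \<omega> k
  proof (rule osc_least)
    fix s t :: 't assume "dist s t < 1 / Suc k"
    also have "\<dots> \<le> 1 / Suc 0"
      by simp
    finally show "infnorm (X s \<omega> - X t \<omega>) \<le> osc D (1 / Suc 0) (\<lambda>t. X t \<omega>)"
      by (rule infnorm_diff_le_osc[OF cont[OF that] bdd[OF that] assms(4)])
  next
    show "D \<noteq> {}"
      using assms(4) by auto
  qed simp
  have "(\<lambda>k. \<integral>\<^sup>+\<omega>. ennreal (osc D (1 / Suc k) (\<lambda>t. X t \<omega>) powr r) \<partial>M)
          \<longlonglongrightarrow> (\<integral>\<^sup>+\<omega>. 0 \<partial>M)"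
  proof (rule nn_integral_dominated_convergence)
    show "AE \<omega> in M. ennreal (osc D (1 / Suc k) (\<lambda>t. X t \<omega>) powr r)
            \<le> ennreal (osc D (1 / Suc 0) (\<lambda>t. X t \<omega>) powr r)" for k
      using mono nn \<open>r > 0\<close> by (intro AE_I2 ennreal_leI powr_mono2) auto
    \<comment> \<open>The factor \<open>2\<close> is moved to the modulus, as \<open>nn_integral_cmult\<close> applies to measurable
      functions.\<close>
    have "(\<integral>\<^sup>+\<omega>. ennreal (osc D (1 / Suc 0) (\<lambda>t. X t \<omega>) powr r) \<partial>M)
        = (\<integral>\<^sup>+\<omega>. ennreal (2 powr r) * ennreal ((osc D (1 / Suc 0) (\<lambda>t. X t \<omega>) / 2) powr r) \<partial>M)"
    proof (rule nn_integral_cong)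
      fix \<omega> assume "\<omega> \<in> space M"
      then have "osc D (1 / Suc 0) (\<lambda>t. X t \<omega>) powr r
          = 2 powr r * (osc D (1 / Suc 0) (\<lambda>t. X t \<omega>) / 2) powr r"
        using nn[of \<omega> 0] by (simp add: powr_divide)
      then show "ennreal (osc D (1 / Suc 0) (\<lambda>t. X t \<omega>) powr r)
          = ennreal (2 powr r) * ennreal ((osc D (1 / Suc 0) (\<lambda>t. X t \<omega>) / 2) powr r)"
        by (metis ennreal_mult' powr_ge_zero)
    qed
    also have "\<dots>
        = ennreal (2 powr r) * (\<integral>\<^sup>+\<omega>. ennreal ((osc D (1 / Suc 0) (\<lambda>t. X t \<omega>) / 2) powr r) \<partial>M)"
      by (rule nn_integral_cmult) measurable
    also have "\<dots> \<le> ennreal (2 powr r) * (\<integral>\<^sup>+\<omega>. ennreal (sup_nrm (\<lambda>t. X t \<omega>) powr r) \<partial>M)"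
      using le[of _ 0] nn[of _ 0] \<open>r > 0\<close>
      by (intro mult_left_mono nn_integral_mono ennreal_leI powr_mono2) auto
    also have "\<dots> < \<infinity>"
      using fin by (simp add: ennreal_mult_less_top)
    finally show "(\<integral>\<^sup>+\<omega>. ennreal (osc D (1 / Suc 0) (\<lambda>t. X t \<omega>) powr r) \<partial>M) < \<infinity>" .
    have "(\<lambda>k. ennreal (osc D (1 / Suc k) (\<lambda>t. X t \<omega>) powr r)) \<longlonglongrightarrow> 0"
      if "\<omega> \<in> space M" for \<omega>
    proof -
      have "(\<lambda>k. osc D (1 / Suc k) (\<lambda>t. X t \<omega>) powr r) \<longlonglongrightarrow> 0 powr r"
        using osc_tendsto_0[OF assms(2) cont[OF that] assms(4)] \<open>r > 0\<close>
        by (intro tendsto_powr2) (auto simp: nn[OF that] simp del: of_nat_Suc)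
      then have "(\<lambda>k. ennreal (osc D (1 / Suc k) (\<lambda>t. X t \<omega>) powr r)) \<longlonglongrightarrow> ennreal 0"
        by (intro tendsto_ennrealI) simp
      then show ?thesis
        by simp
    qed
    then show "AE \<omega> in M. (\<lambda>k. ennreal (osc D (1 / Suc k) (\<lambda>t. X t \<omega>) powr r)) \<longlonglongrightarrow> 0"
      by (intro AE_I2)
  qed measurable
  then show ?lim
    by simp
qed


section \<open>Smoothing by a tent kernel\<close>

definition tent :: "real \<Rightarrow> 't::metric_space \<Rightarrow> 't \<Rightarrow> real" where
  "tent \<delta> t s = max 0 (\<delta> - dist t s)"

definition tent_mean :: "'t::metric_space measure \<Rightarrow> real \<Rightarrow> ('t \<Rightarrow> real ^ 'd) \<Rightarrow> 't \<Rightarrow> real ^ 'd" where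
  "tent_mean \<mu> \<delta> a t = (\<chi> i. (\<integral>s. tent \<delta> t s * a s $ i \<partial>\<mu>) / (\<integral>s. tent \<delta> t s \<partial>\<mu>))"

locale full_support =
  fixes \<mu> :: "'t::metric_space measure"
  assumes compact_UNIV: "compact (UNIV :: 't set)"
    and sets_borel: "sets \<mu> = sets borel"
    and finite_mu: "finite_measure \<mu>"
    and support: "msupport \<mu> = UNIV"
begin

lemma space_UNIV: "space \<mu> = UNIV"
  using sets_eq_imp_space_eq[OF sets_borel] by simp

lemma measurable_mu_iff: "f \<in> borel_measurable \<mu> \<longleftrightarrow> f \<in> borel_measurable borel"
  by (simp add: measurable_cong_sets[OF sets_borel refl])

lemma continuous_measurable: "continuous_on UNIV f \<Longrightarrow> f \<in> borel_measurable \<mu>"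
  by (simp add: measurable_mu_iff borel_measurable_continuous_onI)

text \<open>
  The exceptional set is open and null, so it contains no point of the support.
\<close>

lemma closed_AE_imp_all:
  assumes "closed {t. P t}" "AE t in \<mu>. P t"
  shows "P t"
proof (rule ccontr)
  assume "\<not> P t"
  have op: "open (- {t. P t})"
    using assms(1) by blast
  then have "- {t. P t} \<in> sets \<mu>"
    by (simp add: sets_borel)
  moreover have "- {t. P t} = {t \<in> space \<mu>. \<not> P t}"
    by (auto simp: space_UNIV)
  ultimately have "emeasure \<mu> (- {t. P t}) = 0"
    using assms(2) by (simp only: AE_iff_measurable)
  moreover have "t \<in> msupport \<mu>"
    using support by simp
  then have "emeasure \<mu> (- {t. P t}) > 0"
    using op \<open>\<not> P t\<close> by (auto simp: msupport_def)
  ultimately show False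
    by simp
qed

lemma AE_const_imp: "AE t in \<mu>. P \<Longrightarrow> P"
  using closed_AE_imp_all[of "\<lambda>_. P"] by (cases P) auto

lemma ess_nrm_nonneg:
  fixes f :: "'t \<Rightarrow> real ^ 'd"
  assumes "f \<in> ess_bdd \<mu>"
  shows "0 \<le> ess_nrm \<mu> f"
proof (rule AE_const_imp)
  show "AE t in \<mu>. 0 \<le> ess_nrm \<mu> f"
    using AE_infnorm_le_ess_nrm[OF assms] by eventually_elim (meson infnorm_pos_le order_trans)
qed

lemma bounded_ess_bdd:
  fixes f :: "'t \<Rightarrow> real ^ 'd"
  assumes "f \<in> borel_measurable borel" "bounded (range f)"
  shows "f \<in> ess_bdd \<mu>"
  unfolding ess_bdd_iff measurable_mu_iff
  using assms(1) infnorm_le_sup_nrm[OF assms(2)]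
  by (intro conjI exI[of _ "sup_nrm f"] AE_I2)

lemma ess_nrm_le_sup_nrm:
  fixes f :: "'t \<Rightarrow> real ^ 'd"
  assumes "f \<in> borel_measurable borel" "bounded (range f)"
  shows "ess_nrm \<mu> f \<le> sup_nrm f"
  using assms infnorm_le_sup_nrm[OF assms(2)] sup_nrm_nonneg[OF assms(2)]
  by (intro ess_nrm_least) (auto simp: measurable_mu_iff)

lemma continuous_Mb:
  fixes f :: "'t \<Rightarrow> real ^ 'd"
  assumes "continuous_on UNIV f"
  shows "f \<in> borel_measurable borel" "bounded (range f)"
  using assms continuous_bounded_range[OF compact_UNIV] by (auto intro: borel_measurable_continuous_onI)

lemmas continuous_ess_bdd = bounded_ess_bdd[OF continuous_Mb]

lemma ess_nrm_continuous:
  fixes f :: "'t \<Rightarrow> real ^ 'd"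
  assumes "continuous_on UNIV f"
  shows "ess_nrm \<mu> f = sup_nrm f"
proof (rule antisym)
  have "closed {t. infnorm (f t) \<le> ess_nrm \<mu> f}"
    by (rule closed_Collect_le[OF continuous_on_infnorm[OF assms] continuous_on_const])
  then show "sup_nrm f \<le> ess_nrm \<mu> f"
    by (rule sup_nrm_least[OF
          closed_AE_imp_all[OF _ AE_infnorm_le_ess_nrm[OF continuous_ess_bdd[OF assms assms]]]])
  show "ess_nrm \<mu> f \<le> sup_nrm f"
    by (rule ess_nrm_le_sup_nrm[OF continuous_Mb[OF assms]])
qed

lemma continuous_version_unique:
  fixes f g :: "'t \<Rightarrow> real ^ 'd"
  assumes "continuous_on UNIV f" "continuous_on UNIV g" "g \<in> ae_class \<mu> f"
  shows "g = f"
proof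
  fix t
  have "closed {t. f t = g t}"
    by (rule closed_Collect_eq[OF assms(1,2)])
  moreover have "AE t in \<mu>. f t = g t"
    using assms(3) by (simp add: ae_class_def ae_eq_def)
  ultimately show "g t = f t"
    using closed_AE_imp_all[of "\<lambda>t. f t = g t" t] by simp
qed

lemma tent_measurable [measurable]: "tent \<delta> t \<in> borel_measurable \<mu>"
  unfolding tent_def by (intro continuous_measurable continuous_intros)

lemma tent_bounds: "0 \<le> tent \<delta> t s" "\<delta> > 0 \<Longrightarrow> tent \<delta> t s \<le> \<delta>"
  by (auto simp: tent_def)

lemma tent_integrable:
  assumes "\<delta> > 0"
  shows "integrable \<mu> (tent \<delta> t)"
  using assms tent_bounds[of \<delta> t] by (intro finite_measure.integrable_const_bound[OF finite_mu, of _ \<delta>]) auto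

lemma ess_bdd_component:
  fixes a :: "'t \<Rightarrow> real ^ 'd"
  assumes "a \<in> ess_bdd \<mu>"
  shows "(\<lambda>s. a s $ i) \<in> borel_measurable \<mu>"
    and "AE s in \<mu>. \<bar>a s $ i\<bar> \<le> ess_nrm \<mu> a"
proof -
  have "a \<in> borel_measurable \<mu>"
    using assms by (simp add: ess_bdd_def)
  then show "(\<lambda>s. a s $ i) \<in> borel_measurable \<mu>"
    by (rule borel_measurable_continuous_on[rotated]) (intro continuous_intros)
  show "AE s in \<mu>. \<bar>a s $ i\<bar> \<le> ess_nrm \<mu> a"
    using AE_infnorm_le_ess_nrm[OF assms] by eventually_elim (simp add: infnorm_le_iff_cart)
qed

lemma component_integrable:
  fixes a :: "'t \<Rightarrow> real ^ 'd"
  assumes "a \<in> ess_bdd \<mu>"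
  shows "integrable \<mu> (\<lambda>s. a s $ i)"
  using ess_bdd_component[OF assms]
  by (intro finite_measure.integrable_const_bound[OF finite_mu, of _ "ess_nrm \<mu> a"]) auto

lemma tent_mult_integrable:
  assumes "\<delta> > 0" "integrable \<mu> g"
  shows "integrable \<mu> (\<lambda>s. tent \<delta> t s * g s)"
proof (rule Bochner_Integration.integrable_bound)
  show "integrable \<mu> (\<lambda>s. \<delta> * g s)"
    using assms(2) by simp
  show "(\<lambda>s. tent \<delta> t s * g s) \<in> borel_measurable \<mu>"
    using assms(2) by (intro borel_measurable_times tent_measurable) auto
  show "AE s in \<mu>. norm (tent \<delta> t s * g s) \<le> norm (\<delta> * g s)"
    using assms(1) tent_bounds[of \<delta> t] by (auto simp: abs_mult intro!: AE_I2 mult_right_mono)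
qed

text \<open>
  The kernel is bounded by \<open>\<delta>\<close> and continuous in its first argument, so dominated convergence applies.
\<close>

lemma tent_integral_continuous:
  assumes "\<delta> > 0" "integrable \<mu> g"
  shows "continuous_on UNIV (\<lambda>t. \<integral>s. tent \<delta> t s * g s \<partial>\<mu>)"
  unfolding continuous_on_sequentially
proof safe
  fix u t assume "u \<longlonglongrightarrow> (t :: 't)"
  have "(\<lambda>k. \<integral>s. tent \<delta> (u k) s * g s \<partial>\<mu>) \<longlonglongrightarrow> (\<integral>s. tent \<delta> t s * g s \<partial>\<mu>)"
  proof (rule integral_dominated_convergence)
    show "integrable \<mu> (\<lambda>s. \<delta> * \<bar>g s\<bar>)"
      using assms(2) by simp
    show "(\<lambda>s. tent \<delta> t s * g s) \<in> borel_measurable \<mu>" for t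
      using assms(2) by (intro borel_measurable_times tent_measurable) auto
    then show "(\<lambda>s. tent \<delta> (u k) s * g s) \<in> borel_measurable \<mu>" for k .
    show "AE s in \<mu>. norm (tent \<delta> (u k) s * g s) \<le> \<delta> * \<bar>g s\<bar>" for k
      using assms(1) tent_bounds[of \<delta> "u k"] by (auto simp: abs_mult intro!: AE_I2 mult_right_mono)
    show "AE s in \<mu>. (\<lambda>k. tent \<delta> (u k) s * g s) \<longlonglongrightarrow> tent \<delta> t s * g s"
      unfolding tent_def using \<open>u \<longlonglongrightarrow> t\<close> by (intro AE_I2 tendsto_intros)
  qed
  then show "((\<lambda>t. \<integral>s. tent \<delta> t s * g s \<partial>\<mu>) \<circ> u) \<longlonglongrightarrow> (\<integral>s. tent \<delta> t s * g s \<partial>\<mu>)"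
    by (simp add: comp_def)
qed

text \<open>
  Otherwise the kernel would vanish almost everywhere, hence everywhere as it is continuous and \<open>\<mu>\<close> has
  full support; but its value at \<open>(t, t)\<close> is \<open>\<delta>\<close>.
\<close>

lemma tent_integral_pos:
  assumes "\<delta> > 0"
  shows "0 < (\<integral>s. tent \<delta> t s \<partial>\<mu>)"
proof (rule ccontr)
  assume "\<not> 0 < (\<integral>s. tent \<delta> t s \<partial>\<mu>)"
  moreover have "0 \<le> (\<integral>s. tent \<delta> t s \<partial>\<mu>)"
    by (rule Bochner_Integration.integral_nonneg) (rule tent_bounds(1))
  ultimately have "AE s in \<mu>. tent \<delta> t s = 0"
    using integral_nonneg_eq_0_iff_AE[OF tent_integrable[OF assms], of t] tent_bounds(1) by auto
  moreover have "closed {s. tent \<delta> t s = 0}"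
    unfolding tent_def by (intro closed_Collect_eq continuous_intros)
  ultimately have "tent \<delta> t t = 0"
    using closed_AE_imp_all by blast
  then show False
    using assms by (simp add: tent_def)
qed

lemma tent_mean_continuous:
  fixes a :: "'t \<Rightarrow> real ^ 'd"
  assumes "\<delta> > 0" "a \<in> ess_bdd \<mu>"
  shows "continuous_on UNIV (tent_mean \<mu> \<delta> a)"
proof -
  have "integrable \<mu> (\<lambda>_. 1 :: real)"
    using finite_mu by (simp add: finite_measure.integrable_const)
  from tent_integral_continuous[OF assms(1) this]
  have "continuous_on UNIV (\<lambda>t. \<integral>s. tent \<delta> t s \<partial>\<mu>)"
    by simp
  moreover have "(\<integral>s. tent \<delta> t s \<partial>\<mu>) \<noteq> 0" for t
    using tent_integral_pos[OF assms(1), of t] by simp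
  ultimately show ?thesis
    unfolding tent_mean_def
    by (intro continuous_on_vec_lambda continuous_on_divide ballI
        tent_integral_continuous component_integrable assms)
qed

text \<open>
  The smoothing estimate. Only points \<open>s\<close> with \<open>d(t, s) < \<delta>\<close> carry weight in the mean at \<open>t\<close>, and
  for almost all of them \<open>a s\<close> differs from \<open>f t\<close> by at most \<open>\<parallel>f - a\<parallel>\<^sub>\<infinity> + w\<close>. The argument is carried out
  for each coordinate, which suffices for the \<open>l\<^sup>\<infinity>\<close>-norm on \<open>\<real>\<^sup>d\<close>.
\<close>

lemma sup_nrm_tent_mean_le:
  fixes a f :: "'t \<Rightarrow> real ^ 'd"
  assumes "\<delta> > 0" "a \<in> ess_bdd \<mu>" "f \<in> ess_bdd \<mu>"
    and w: "\<And>s t. dist s t < \<delta> \<Longrightarrow> infnorm (f s - f t) \<le> w"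
  shows "sup_nrm (\<lambda>t. f t - tent_mean \<mu> \<delta> a t) \<le> ess_nrm \<mu> (\<lambda>t. f t - a t) + w"
proof (rule sup_nrm_least)
  fix t
  let ?R = "ess_nrm \<mu> (\<lambda>t. f t - a t)"
  let ?K = "\<integral>s. tent \<delta> t s \<partial>\<mu>"
  have K: "?K > 0"
    using assms(1) by (rule tent_integral_pos)
  have "\<bar>f t $ i - tent_mean \<mu> \<delta> a t $ i\<bar> \<le> ?R + w" for i
  proof -
    note int = tent_mult_integrable[OF assms(1) component_integrable[OF assms(2)], of t i]
      tent_integrable[OF assms(1), of t]
    have "AE s in \<mu>. infnorm (f s - a s) \<le> ?R"
      by (rule AE_infnorm_le_ess_nrm[OF ess_bdd_diff[OF assms(3,2)]])
    then have AE: "AE s in \<mu>. \<bar>tent \<delta> t s * (f t $ i - a s $ i)\<bar> \<le> tent \<delta> t s * (?R + w)"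
    proof eventually_elim
      case (elim s)
      show ?case
      proof (cases "dist t s < \<delta>")
        case True
        have "\<bar>(f t - a s) $ i\<bar> \<le> infnorm (f t - a s)"
          by (rule component_le_infnorm_cart)
        also have "\<dots> \<le> infnorm (f t - f s) + infnorm (f s - a s)"
          by (rule infnorm_diff_triangle)
        also have "\<dots> \<le> ?R + w"
          using w[OF True] elim by simp
        finally show ?thesis
          using tent_bounds(1)[of \<delta> t s] by (simp add: abs_mult mult_left_mono)
      qed (simp add: tent_def)
    qed
    have int2: "integrable \<mu> (\<lambda>s. tent \<delta> t s * (f t $ i - a s $ i))"
      using int by (simp add: right_diff_distrib)
    have "(\<integral>s. tent \<delta> t s * (f t $ i - a s $ i) \<partial>\<mu>) = f t $ i * ?K - (\<integral>s. tent \<delta> t s * a s $ i \<partial>\<mu>)"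
      using int by (simp add: right_diff_distrib mult.commute)
    then have eq: "f t $ i - tent_mean \<mu> \<delta> a t $ i
        = (\<integral>s. tent \<delta> t s * (f t $ i - a s $ i) \<partial>\<mu>) / ?K"
      using K by (simp add: tent_mean_def diff_divide_distrib)
    have "\<bar>\<integral>s. tent \<delta> t s * (f t $ i - a s $ i) \<partial>\<mu>\<bar> \<le> (\<integral>s. tent \<delta> t s * (?R + w) \<partial>\<mu>)"
      using int(2)
      by (intro order_trans[OF integral_abs_bound integral_mono_AE[OF integrable_abs[OF int2] _ AE]]
          integrable_mult_left)
    also have "\<dots> = ?K * (?R + w)"
      by simp
    finally show ?thesis
      using K unfolding eq by (simp add: abs_divide pos_divide_le_eq mult.commute)
  qed
  then show "infnorm (f t - tent_mean \<mu> \<delta> a t) \<le> ?R + w"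
    by (simp add: infnorm_le_iff_cart)
qed

end

section \<open>Comparison of the quantization errors\<close>

lemma C_space_simps:
  "pts C_space = {f. continuous_on UNIV f}" "nsub C_space f g = (\<lambda>t. f t - g t)"
  "nrm C_space = sup_nrm"
  by (auto simp: C_space_def)

lemma Mb_space_simps:
  "pts Mb_space = {f. f \<in> borel_measurable borel \<and> bounded (range f)}"
  "nsub Mb_space f g = (\<lambda>t. f t - g t)" "nrm Mb_space = sup_nrm"
  by (auto simp: Mb_space_def)

locale continuous_process = full_support \<mu>
  for \<mu> :: "'t::metric_space measure" +
  fixes M :: "'w measure"
    and X :: "'t \<Rightarrow> 'w \<Rightarrow> real ^ 'd"
    and r :: real
  assumes r_pos: "r > 0"
    and meas: "\<And>t. X t \<in> borel_measurable M"
    and cont: "\<And>\<omega>. \<omega> \<in> space M \<Longrightarrow> continuous_on UNIV (\<lambda>t. X t \<omega>)"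
    and moment: "(\<integral>\<^sup>+\<omega>. ennreal (sup_nrm (\<lambda>t. X t \<omega>) powr r) \<partial>M) < \<infinity>"
begin

abbreviation path :: "'w \<Rightarrow> 't \<Rightarrow> real ^ 'd" where
  "path \<equiv> \<lambda>\<omega> t. X t \<omega>"

abbreviation path_class :: "'w \<Rightarrow> ('t \<Rightarrow> real ^ 'd) set" where
  "path_class \<equiv> \<lambda>\<omega>. ae_class \<mu> (\<lambda>t. X t \<omega>)"

abbreviation "err_C \<equiv> quant_err M r path C_space"
abbreviation "err_Mb \<equiv> quant_err M r path Mb_space"
abbreviation "err_Linf \<equiv> quant_err M r path_class (Linf_space \<mu>)"
abbreviation "min_C n \<equiv> min_quant_err M n r path C_space"
abbreviation "min_Mb n \<equiv> min_quant_err M n r path Mb_space"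
abbreviation "min_Linf n \<equiv> min_quant_err M n r path_class (Linf_space \<mu>)"

lemma path_ess_bdd: "\<omega> \<in> space M \<Longrightarrow> path \<omega> \<in> ess_bdd \<mu>"
  using cont continuous_ess_bdd by blast

lemma err_C_eq_err_Mb: "err_C = err_Mb"
  by (intro ext) (simp add: quant_err_def C_space_simps Mb_space_simps)

lemma codebooks_C:
  "\<alpha> \<in> codebooks n C_space
   \<longleftrightarrow> \<alpha> \<in> codebooks n (Mb_space :: ('t \<Rightarrow> real ^ 'd) normed_sp) \<and> \<alpha> \<subseteq> pts C_space"
  using continuous_Mb by (auto simp: codebooks_def C_space_simps Mb_space_simps)

lemma min_Mb_le_min_C: "min_Mb n \<le> min_C n"
  unfolding min_quant_err_def err_C_eq_err_Mb by (rule INF_superset_mono) (use codebooks_C in blast)+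

lemma err_Linf_image_le:
  assumes "\<alpha> \<in> codebooks n Mb_space"
  shows "err_Linf (ae_class \<mu> ` \<alpha>) \<le> err_Mb \<alpha>"
proof (rule quant_err_image_le[OF r_pos codebook_finite_nonempty(1,2)[OF assms]], goal_cases)
  case (1 \<omega> a)
  then have a: "a \<in> borel_measurable borel" "bounded (range a)"
    using codebook_finite_nonempty(3)[OF assms] by (auto simp: Mb_space_simps)
  note x = continuous_Mb[OF cont[OF 1(1)]]
  note b = bounded_ess_bdd[OF a] path_ess_bdd[OF 1(1)]
  have "bounded (range (\<lambda>t. X t \<omega> - a t))"
    using x(2) a(2) by (rule bounded_minus_comp)
  then have "ess_nrm \<mu> (\<lambda>t. X t \<omega> - a t) \<le> sup_nrm (\<lambda>t. X t \<omega> - a t)"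
    using x(1) a(1) by (intro ess_nrm_le_sup_nrm borel_measurable_diff)
  then show ?case
    using b ess_nrm_nonneg[OF ess_bdd_diff[OF b(2,1)]] by (simp add: nrm_Linf_diff Mb_space_simps)
qed

lemma min_Linf_le_min_Mb: "min_Linf n \<le> min_Mb n"
  unfolding min_quant_err_def
proof (rule INF_mono)
  fix \<alpha> :: "('t \<Rightarrow> real ^ 'd) set" assume \<alpha>: "\<alpha> \<in> codebooks n Mb_space"
  have "ae_class \<mu> ` \<alpha> \<in> codebooks n (Linf_space \<mu>)"
    using codebook_finite_nonempty(3)[OF \<alpha>]
    by (intro codebook_image[OF \<alpha>] ae_class_point bounded_ess_bdd) (auto simp: Mb_space_simps)
  then show "\<exists>\<beta>\<in>codebooks n (Linf_space \<mu>). err_Linf \<beta> \<le> err_Mb \<alpha>"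
    using err_Linf_image_le[OF \<alpha>] by blast
qed

text \<open>
  Differences of continuous functions are continuous, so the distances of the paths to the codewords
  are the same in both norms.
\<close>

lemma err_Linf_image_C:
  assumes "\<alpha> \<subseteq> pts C_space"
  shows "err_Linf (ae_class \<mu> ` \<alpha>) = err_C \<alpha>"
proof -
  have "nrm (Linf_space \<mu>) (nsub (Linf_space \<mu>) (path_class \<omega>) (ae_class \<mu> a))
      = nrm C_space (nsub C_space (path \<omega>) a)" if "\<omega> \<in> space M" "a \<in> \<alpha>" for \<omega> a
  proof -
    have a: "continuous_on UNIV a"
      using assms that(2) by (auto simp: C_space_simps)
    then have "continuous_on UNIV (\<lambda>t. X t \<omega> - a t)"
      using cont[OF that(1)] by (rule continuous_on_diff[rotated])
    then show ?thesis
      using nrm_Linf_diff[OF path_ess_bdd[OF that(1)] continuous_ess_bdd[OF a a]]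
      by (simp add: C_space_simps ess_nrm_continuous)
  qed
  then show ?thesis
    unfolding quant_err_def by (intro arg_cong[of _ _ "ennroot r"] nn_integral_cong)
      (simp add: image_image cong: image_cong_simp)
qed

text \<open>
  Smoothing the codewords of \<open>\<beta>\<close> with \<open>\<delta> = 1 / Suc k\<close> gives codebooks of continuous functions whose
  \<open>r\<close>-th moments of the distance exceed \<open>(1 + \<theta>)\<^sup>r\<close> times that of \<open>\<beta>\<close> by at most a quantity that vanishes as
  \<open>k \<rightarrow> \<infinity>\<close>. Then \<open>\<theta>\<close> tends to \<open>0\<close>.
\<close>

lemma min_C_le_min_Linf: "min_C n \<le> min_Linf n"
  unfolding min_quant_err_def[of M n r path_class]
proof (rule INF_greatest)
  fix \<beta> assume \<beta>: "\<beta> \<in> codebooks n (Linf_space \<mu> :: ('t \<Rightarrow> real ^ 'd) set normed_sp)"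
  note fin = codebook_finite_nonempty[OF \<beta>]
  let ?Z = "\<lambda>\<omega> A. nrm (Linf_space \<mu>) (nsub (Linf_space \<mu>) (path_class \<omega>) A)"
  let ?I = "\<integral>\<^sup>+\<omega>. ennreal (Min ((\<lambda>A. ?Z \<omega> A powr r) ` \<beta>)) \<partial>M"
  show "min_C n \<le> err_Linf \<beta>"
  proof (cases "?I = \<infinity>")
    case True
    then show ?thesis
      by (simp add: quant_err_def ennroot_def)
  next
    case False
    then obtain I where I: "?I = ennreal I" "I \<ge> 0"
      by (cases ?I) auto
    obtain D :: "'t set" where D: "countable D" "closure D = UNIV"
      using compact_metric_countable_dense[OF compact_UNIV] .
    define W where "W k = (\<integral>\<^sup>+\<omega>. ennreal (osc D (1 / Suc k) (path \<omega>) powr r) \<partial>M)" for k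
    have W: "W \<longlonglongrightarrow> 0"
      unfolding W_def by (rule osc_moment_tendsto_0[OF r_pos compact_UNIV D meas cont moment])
    have osc_meas [measurable]: "(\<lambda>\<omega>. osc D \<delta> (path \<omega>)) \<in> borel_measurable M" for \<delta>
      by (rule osc_moment_tendsto_0[OF r_pos compact_UNIV D meas cont moment])
    define rep :: "('t \<Rightarrow> real ^ 'd) set \<Rightarrow> ('t \<Rightarrow> real ^ 'd)" where "rep A = (SOME a. a \<in> A)" for A
    have rep: "rep A \<in> ess_bdd \<mu>" "A = ae_class \<mu> (rep A)" if "A \<in> \<beta>" for A
    proof -
      have "A \<in> pts (Linf_space \<mu>)"
        using fin(3) that by blast
      moreover from this have "rep A \<in> A"
        unfolding rep_def using Linf_point_nonempty by (metis some_in_eq)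
      ultimately show "rep A \<in> ess_bdd \<mu>" "A = ae_class \<mu> (rep A)"
        by (rule Linf_point_class)+
    qed
    have Z: "?Z \<omega> A = ess_nrm \<mu> (\<lambda>t. X t \<omega> - rep A t)" "?Z \<omega> A \<ge> 0"
      if "\<omega> \<in> space M" "A \<in> \<beta>" for \<omega> A
    proof -
      show "?Z \<omega> A = ess_nrm \<mu> (\<lambda>t. X t \<omega> - rep A t)"
        using nrm_Linf_diff[OF path_ess_bdd[OF that(1)] rep(1)[OF that(2)]]
        by (simp flip: rep(2)[OF that(2)])
      then show "?Z \<omega> A \<ge> 0"
        using ess_nrm_nonneg[OF ess_bdd_diff[OF path_ess_bdd[OF that(1)] rep(1)[OF that(2)]]] by simp
    qed
    define \<alpha> where "\<alpha> k = (\<lambda>A. tent_mean \<mu> (1 / Suc k) (rep A)) ` \<beta>" for k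
    have \<alpha>: "\<alpha> k \<in> codebooks n C_space" for k
      unfolding \<alpha>_def
      by (intro codebook_image[OF \<beta>]) (auto simp: C_space_simps intro!: tent_mean_continuous rep)
    let ?J = "\<lambda>k. \<integral>\<^sup>+\<omega>. ennreal (Min ((\<lambda>a. sup_nrm (\<lambda>t. X t \<omega> - a t) powr r) ` \<alpha> k)) \<partial>M"
    have J: "?J k \<le> ennreal ((1 + \<theta>) powr r * I) + ennreal ((1 + 1 / \<theta>) powr r) * W k"
      if "\<theta> > 0" for \<theta> k
    proof -
      let ?w = "\<lambda>\<omega>. osc D (1 / Suc k) (path \<omega>)"
      let ?c = "(1 + \<theta>) powr r" and ?d = "(1 + 1 / \<theta>) powr r"
      have "Min ((\<lambda>a. sup_nrm (\<lambda>t. X t \<omega> - a t) powr r) ` \<alpha> k)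
          \<le> ?c * Min ((\<lambda>A. ?Z \<omega> A powr r) ` \<beta>) + ?d * ?w \<omega> powr r" if \<omega>: "\<omega> \<in> space M" for \<omega>
      proof -
        have "Min ((\<lambda>A. ?Z \<omega> A powr r) ` \<beta>) \<in> (\<lambda>A. ?Z \<omega> A powr r) ` \<beta>"
          using fin(1,2) by (intro Min_in) simp_all
        then obtain A where A: "A \<in> \<beta>" "Min ((\<lambda>A. ?Z \<omega> A powr r) ` \<beta>) = ?Z \<omega> A powr r"
          by (rule imageE)
        let ?a = "tent_mean \<mu> (1 / Suc k) (rep A)"
        have a: "continuous_on UNIV ?a"
          by (intro tent_mean_continuous rep A) simp
        note bdd = continuous_Mb(2)[OF cont[OF \<omega>]]
        have "Min ((\<lambda>a. sup_nrm (\<lambda>t. X t \<omega> - a t) powr r) ` \<alpha> k)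
            \<le> sup_nrm (\<lambda>t. X t \<omega> - ?a t) powr r"
          using fin(1) A(1) by (intro Min_le) (auto simp: \<alpha>_def)
        also have "\<dots> \<le> (?Z \<omega> A + ?w \<omega>) powr r"
        proof (rule powr_mono2)
          show "0 \<le> sup_nrm (\<lambda>t. X t \<omega> - ?a t)"
            by (intro sup_nrm_nonneg continuous_Mb continuous_on_diff cont \<omega> a)
          show "sup_nrm (\<lambda>t. X t \<omega> - ?a t) \<le> ?Z \<omega> A + ?w \<omega>"
            unfolding Z(1)[OF \<omega> A(1)]
            by (rule sup_nrm_tent_mean_le[OF _ rep(1)[OF A(1)] path_ess_bdd[OF \<omega>]
                  infnorm_diff_le_osc[OF cont[OF \<omega>] bdd D(2)]]) auto
        qed (use r_pos in simp)
        also have "\<dots> \<le> ?c * ?Z \<omega> A powr r + ?d * ?w \<omega> powr r"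
          using Z(2)[OF \<omega> A(1)] osc_nonneg[OF cont[OF \<omega>] bdd D(2), of "1 / Suc k"] r_pos \<open>\<theta> > 0\<close>
          by (intro powr_add_le) auto
        finally show ?thesis
          by (simp add: A(2))
      qed
      then have "?J k \<le> (\<integral>\<^sup>+\<omega>. ennreal ?c * ennreal (Min ((\<lambda>A. ?Z \<omega> A powr r) ` \<beta>))
          + ennreal ?d * ennreal (?w \<omega> powr r) \<partial>M)"
        using fin(1,2)
        by (intro nn_integral_mono) (auto simp flip: ennreal_mult ennreal_plus intro!: ennreal_leI)
      also have "\<dots> \<le> (\<integral>\<^sup>+\<omega>. ennreal ?c * ennreal (Min ((\<lambda>A. ?Z \<omega> A powr r) ` \<beta>)) \<partial>M)
          + (\<integral>\<^sup>+\<omega>. ennreal ?d * ennreal (?w \<omega> powr r) \<partial>M)"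
        by (rule nn_integral_add_le) measurable
      also have "(\<integral>\<^sup>+\<omega>. ennreal ?d * ennreal (?w \<omega> powr r) \<partial>M) = ennreal ?d * W k"
        unfolding W_def by (rule nn_integral_cmult) measurable
      also have "(\<integral>\<^sup>+\<omega>. ennreal ?c * ennreal (Min ((\<lambda>A. ?Z \<omega> A powr r) ` \<beta>)) \<partial>M) \<le> ennreal ?c * ?I"
        using \<open>\<theta> > 0\<close> by (intro nn_integral_cmult_le) simp
      also have "\<dots> = ennreal (?c * I)"
        using I by (simp add: ennreal_mult)
      finally show ?thesis
        by (simp add: add_right_mono)
    qed
    \<comment> \<open>Any \<open>y > I\<close> leaves room for the factor \<open>(1 + \<theta>)\<^sup>r\<close> with \<open>\<theta>\<close> small, and then for the modulus with
      \<open>k\<close> large.\<close>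
    have bound: "min_C n \<le> ennreal (y powr (1 / r))" if "y > I" for y
    proof -
      have "((\<lambda>\<theta>. (1 + \<theta>) powr r * I) \<longlongrightarrow> (1 + 0) powr r * I) (at_right 0)"
        by (intro tendsto_intros) auto
      then have "\<forall>\<^sub>F \<theta> in at_right 0. (1 + \<theta>) powr r * I < y"
        using that by (intro order_tendstoD(2)) auto
      then have "\<forall>\<^sub>F \<theta> in at_right 0. (1 + \<theta>) powr r * I < y \<and> \<theta> > 0"
        by (intro eventually_conj eventually_at_right_less)
      then obtain \<theta> :: real where \<theta>: "\<theta> > 0" "(1 + \<theta>) powr r * I < y"
        using eventually_happens'[OF trivial_limit_at_right_real] by blast
      have "(\<lambda>k. ennreal ((1 + \<theta>) powr r * I) + ennreal ((1 + 1 / \<theta>) powr r) * W k)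
          \<longlonglongrightarrow> ennreal ((1 + \<theta>) powr r * I) + ennreal ((1 + 1 / \<theta>) powr r) * 0"
        using W by (intro tendsto_add tendsto_const ennreal_tendsto_cmult) auto
      then have "\<forall>\<^sub>F k in sequentially.
          ennreal ((1 + \<theta>) powr r * I) + ennreal ((1 + 1 / \<theta>) powr r) * W k < ennreal y"
        using \<theta> I by (intro order_tendstoD(2)) (auto simp: ennreal_less_iff)
      then obtain k where "ennreal ((1 + \<theta>) powr r * I) + ennreal ((1 + 1 / \<theta>) powr r) * W k < ennreal y"
        using eventually_happens by fastforce
      then have "?J k \<le> ennreal y"
        using J[OF \<theta>(1), of k] by (meson le_less_trans less_imp_le)
      then have "err_C (\<alpha> k) \<le> ennroot r (ennreal y)"
        unfolding quant_err_def C_space_simps by (rule ennroot_mono[OF r_pos])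
      also have "\<dots> = ennreal (y powr (1 / r))"
        using that I by (simp add: ennroot_def)
      finally show ?thesis
        unfolding min_quant_err_def using INF_lower2[OF \<alpha>] by blast
    qed
    have "((\<lambda>y. ennreal (y powr (1 / r))) \<longlongrightarrow> ennreal (I powr (1 / r))) (at_right I)"
      using r_pos I
      by (intro tendsto_ennrealI tendsto_powr2 tendsto_intros) (auto simp: eventually_at_filter)
    moreover have "\<forall>\<^sub>F y in at_right I. min_C n \<le> ennreal (y powr (1 / r))"
      using bound eventually_at_right_less by (rule eventually_mono[rotated])
    ultimately have "min_C n \<le> ennreal (I powr (1 / r))"
      by (rule tendsto_lowerbound) simp
    also have "\<dots> = err_Linf \<beta>"
      using I by (simp add: quant_err_def ennroot_def)
    finally show ?thesis .
  qed
qed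

lemma min_quant_err_eq: "min_C n = min_Mb n" "min_Mb n = min_Linf n"
  using min_Mb_le_min_C[of n] min_Linf_le_min_Mb[of n] min_C_le_min_Linf[of n] by auto

lemma opt_codebooks_C:
  "opt_codebooks M n r path C_space = {\<alpha> \<in> opt_codebooks M n r path Mb_space. \<alpha> \<subseteq> pts C_space}"
  by (auto simp only: opt_codebooks_def mem_Collect_eq codebooks_C err_C_eq_err_Mb min_quant_err_eq(1))

lemma inj_on_ae_class: "inj_on (ae_class \<mu>) (pts C_space :: ('t \<Rightarrow> real ^ 'd) set)"
proof (rule inj_onI)
  fix f g :: "'t \<Rightarrow> real ^ 'd"
  assume "f \<in> pts C_space" "g \<in> pts C_space" and eq: "ae_class \<mu> f = ae_class \<mu> g"
  then have cont: "continuous_on UNIV f" "continuous_on UNIV g"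
    by (simp_all add: C_space_simps)
  have "f \<in> ae_class \<mu> g"
    using ae_class_point(2)[OF continuous_ess_bdd[OF cont(1) cont(1)]] by (simp add: eq)
  then show "f = g"
    by (rule continuous_version_unique[OF cont(2,1)])
qed

lemma cont_versions_image:
  assumes "\<alpha> \<subseteq> (pts C_space :: ('t \<Rightarrow> real ^ 'd) set)"
  shows "cont_versions (ae_class \<mu> ` \<alpha>) = \<alpha>"
proof (intro equalityI subsetI)
  fix f assume "f \<in> cont_versions (ae_class \<mu> ` \<alpha>)"
  then obtain a where a: "continuous_on UNIV f" "a \<in> \<alpha>" "f \<in> ae_class \<mu> a"
    unfolding cont_versions_def by blast
  moreover from a have "continuous_on UNIV a"
    using assms by (auto simp: C_space_simps)
  ultimately show "f \<in> \<alpha>"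
    using continuous_version_unique[of a f] by simp
next
  fix f assume "f \<in> \<alpha>"
  moreover from this have "continuous_on UNIV f"
    using assms by (auto simp: C_space_simps)
  moreover from this have "f \<in> ae_class \<mu> f"
    by (intro ae_class_point(2) continuous_ess_bdd)
  ultimately show "f \<in> cont_versions (ae_class \<mu> ` \<alpha>)"
    unfolding cont_versions_def by blast
qed

lemma image_cont_versions:
  assumes "\<beta> \<subseteq> pts (Linf_space \<mu> :: ('t \<Rightarrow> real ^ 'd) set normed_sp)"
    and "\<forall>A\<in>\<beta>. \<exists>f\<in>A. f \<in> pts C_space"
  shows "ae_class \<mu> ` cont_versions \<beta> = \<beta>"
proof (intro equalityI subsetI)
  fix A assume "A \<in> ae_class \<mu> ` cont_versions \<beta>"
  then obtain f B where "A = ae_class \<mu> f" "B \<in> \<beta>" "f \<in> B"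
    by (auto simp: cont_versions_def)
  then show "A \<in> \<beta>"
    using Linf_point_class(2)[of B \<mu> f] assms(1) by auto
next
  fix A assume A: "A \<in> \<beta>"
  then obtain f where f: "f \<in> A" "f \<in> pts C_space"
    using assms(2) by blast
  then have "f \<in> cont_versions \<beta>"
    using A by (auto simp: cont_versions_def C_space_simps)
  moreover have "A = ae_class \<mu> f"
    using Linf_point_class(2)[of A \<mu> f] assms(1) A f(1) by blast
  ultimately show "A \<in> ae_class \<mu> ` cont_versions \<beta>"
    by blast
qed

lemma opt_image_iff:
  assumes "\<alpha> \<subseteq> (pts C_space :: ('t \<Rightarrow> real ^ 'd) set)"
  shows "ae_class \<mu> ` \<alpha> \<in> opt_codebooks M n r path_class (Linf_space \<mu>)
         \<longleftrightarrow> \<alpha> \<in> opt_codebooks M n r path C_space"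
proof -
  have "card (ae_class \<mu> ` \<alpha>) = card \<alpha>"
    using inj_on_subset[OF inj_on_ae_class assms] by (rule card_image)
  moreover have "ae_class \<mu> ` \<alpha> \<subseteq> pts (Linf_space \<mu>)"
    using assms ae_class_point(1)[OF continuous_ess_bdd] by (auto simp: C_space_simps)
  ultimately show ?thesis
    using assms unfolding opt_codebooks_def codebooks_def mem_Collect_eq err_Linf_image_C[OF assms]
      min_quant_err_eq(1) min_quant_err_eq(2) by simp
qed

lemma opt_codebooks_C_versions:
  "opt_codebooks M n r path C_space
   = {cont_versions \<beta> |\<beta>. \<beta> \<in> opt_codebooks M n r path_class (Linf_space \<mu>)
                          \<and> (\<forall>A\<in>\<beta>. \<exists>f\<in>A. f \<in> pts C_space)}" (is "?L = ?R")
proof (intro equalityI subsetI)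
  fix \<alpha> assume \<alpha>: "\<alpha> \<in> ?L"
  then have sub: "\<alpha> \<subseteq> pts C_space"
    by (simp add: opt_codebooks_def codebooks_def)
  have "\<exists>f\<in>ae_class \<mu> a. f \<in> pts C_space" if "a \<in> \<alpha>" for a
  proof (rule bexI)
    show a: "a \<in> pts C_space"
      using sub that by blast
    then show "a \<in> ae_class \<mu> a"
      by (intro ae_class_point(2) continuous_ess_bdd) (simp_all add: C_space_simps)
  qed
  moreover have "ae_class \<mu> ` \<alpha> \<in> opt_codebooks M n r path_class (Linf_space \<mu>)"
    using opt_image_iff[OF sub] \<alpha> by simp
  ultimately show "\<alpha> \<in> ?R"
    using cont_versions_image[OF sub] by (intro CollectI exI[of _ "ae_class \<mu> ` \<alpha>"]) simp
next
  fix \<alpha> assume "\<alpha> \<in> ?R"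
  then obtain \<beta> where \<beta>: "\<alpha> = cont_versions \<beta>"
      "\<beta> \<in> opt_codebooks M n r path_class (Linf_space \<mu>)" "\<forall>A\<in>\<beta>. \<exists>f\<in>A. f \<in> pts C_space"
    by blast
  have "ae_class \<mu> ` \<alpha> = \<beta>"
    unfolding \<beta>(1) using \<beta>(2,3)
    by (intro image_cont_versions) (auto simp: opt_codebooks_def codebooks_def)
  moreover have "\<alpha> \<subseteq> pts C_space"
    by (auto simp: \<beta>(1) cont_versions_def C_space_simps)
  ultimately show "\<alpha> \<in> ?L"
    using opt_image_iff[of \<alpha> n] \<beta>(2) by simp
qed

end

theorem theorem4:
  fixes M :: "'w measure"
    and X :: "'t::metric_space \<Rightarrow> 'w \<Rightarrow> real ^ 'd"
    and \<mu> :: "'t measure"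
    and r :: real
    and n :: nat
  assumes "r > 0"
    and "n \<ge> 1"
    and "compact (UNIV :: 't set)"
    and "prob_space M"
    and "\<And>t. X t \<in> borel_measurable M"
    and "\<And>\<omega>. \<omega> \<in> space M \<Longrightarrow> continuous_on UNIV (\<lambda>t. X t \<omega>)"
    and "(\<integral>\<^sup>+\<omega>. ennreal (sup_nrm (\<lambda>t. X t \<omega>) powr r) \<partial>M) < \<infinity>"
    and "sets \<mu> = sets borel"
    and "finite_measure \<mu>"
    and "msupport \<mu> = UNIV"
  shows
    "min_quant_err M n r (\<lambda>\<omega> t. X t \<omega>) C_space = min_quant_err M n r (\<lambda>\<omega> t. X t \<omega>) Mb_space
     \<and> min_quant_err M n r (\<lambda>\<omega> t. X t \<omega>) Mb_space
         = min_quant_err M n r (\<lambda>\<omega>. ae_class \<mu> (\<lambda>t. X t \<omega>)) (Linf_space \<mu>)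
     \<and> opt_codebooks M n r (\<lambda>\<omega> t. X t \<omega>) C_space
         = {\<alpha> \<in> opt_codebooks M n r (\<lambda>\<omega> t. X t \<omega>) Mb_space. \<alpha> \<subseteq> pts C_space}
     \<and> {\<alpha> \<in> opt_codebooks M n r (\<lambda>\<omega> t. X t \<omega>) Mb_space. \<alpha> \<subseteq> pts C_space}
         = {cont_versions \<alpha> |\<alpha>. \<alpha> \<in> opt_codebooks M n r (\<lambda>\<omega>. ae_class \<mu> (\<lambda>t. X t \<omega>)) (Linf_space \<mu>)
                                \<and> (\<forall>A\<in>\<alpha>. \<exists>f\<in>A. f \<in> pts C_space)}"
proof -
  interpret continuous_process \<mu> M X r
    by (intro continuous_process.intro full_support.intro continuous_process_axioms.intro) (fact assms)+
  show ?thesis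
    by (intro conjI min_quant_err_eq opt_codebooks_C opt_codebooks_C_versions[unfolded opt_codebooks_C])
qed

end
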